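(* Let $q=p^h$ with $p$ prime and $h\ge 1$, let $n$ be a positive integer, let $I,J$ be positive integers with $I<J<n/2$ and $\gcd(I,J,n)=1$, and put $K:=J-I$. Then the scattered sets $U_{\alpha,\beta,\gamma}^{I,J,n}$ (with $(\alpha,\beta,\gamma)\in(\mathbb{F}_{q^n}^* )^3$ such that $\alpha\gamma^{q^K}\beta^{q^K+1}$ is not a $(q^{2K}+q^K+1)$-th power in $\mathbb{F}_{q^n}$) fall into at least $$\frac{1}{3nh}\left(\gcd(q^{3K}-1,q^n-1)-\frac{\gcd(q^{3K}-1,q^n-1)}{\gcd(q^{2K}+q^K+1,q^n-1)}\right)$$ $\Gamma L(6,q^n)$-equivalence classes.
   Context: For positive integers $I<J<n$ and $\alpha,\beta,\gamma\in\mathbb{F}_{q^n}^*$, $$U_{\alpha,\beta,\gamma}^{I,J,n}:=\{(x,y,z,\;x^{q^I}+\alpha y^{q^J},\;x^{q^J}+\beta z^{q^I},\;y^{q^I}+\gamma z^{q^J}) : x,y,z\in\mathbb{F}_{q^n}\}\subseteq\mathbb{F}_{q^n}^6 .$$ An $\mathbb{F}_q$-subspace $U$ of $\mathbb{F}_{q^n}^6$ is scattered if every one-dimensional $\mathbb{F}_{q^n}$-subspace of $\mathbb{F}_{q^n}^6$ meets $U$ in an $\mathbb{F}_q$-subspace of $\mathbb{F}_q$-dimension at most $1$. Two $\mathbb{F}_q$-subspaces $U,U'$ of $\mathbb{F}_{q^n}^6$ are $\Gamma L(6,q^n)$-equivalent if there exist $M\in GL(6,\mathbb{F}_{q^n})$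 and a field automorphism $\sigma\in\mathrm{Aut}(\mathbb{F}_{q^n})$ such that $U'=\{M u^{\sigma} : u\in U\}$, where $\sigma$ acts coordinatewise on column vectors. An element $c\in\mathbb{F}_{q^n}$ is a $d$-th power in $\mathbb{F}_{q^n}$ if $c=\xi^d$ for some $\xi\in\mathbb{F}_{q^n}$. *)

theory Defs
  imports
    "HOL-Analysis.Analysis"
    "HOL-Computational_Algebra.Primes"
    "HOL-Computational_Algebra.Nth_Powers"
begin

definition field_hom :: "('a::field \<Rightarrow> 'b::field) \<Rightarrow> bool" where
  "field_hom f \<longleftrightarrow> f 1 = 1 \<and> (\<forall>x y. f (x + y) = f x + f y) \<and> (\<forall>x y. f (x * y) = f x * f y)"

definition field_aut :: "('a::field \<Rightarrow> 'a) \<Rightarrow> bool" where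
  "field_aut s \<longleftrightarrow> field_hom s \<and> bij s"

text \<open>
  The field with q elements is a type 'k and its extension of degree n is a type 'a. The former
  acts on vectors over the latter through a field embedding emb. The image of emb is the unique
  subfield of 'a with q elements, so the choice of emb is immaterial.
\<close>

definition sub_scale :: "('k::field \<Rightarrow> 'a::field) \<Rightarrow> 'k \<Rightarrow> 'a ^ 'm \<Rightarrow> 'a ^ 'm" where
  "sub_scale emb c v = emb c *s v"

lemma vector_space_sub_scale:
  assumes "field_hom emb"
  shows "vector_space (sub_scale emb :: 'k::field \<Rightarrow> 'a::field ^ 'm \<Rightarrow> 'a ^ 'm)"
  using assms
  by unfold_locales
    (simp_all add: sub_scale_def field_hom_def vec.scale_right_distrib vec.scale_left_distrib)

definition scattered :: "('k::field \<Rightarrow> 'a::field) \<Rightarrow> ('a ^ 'm) set \<Rightarrow> bool" where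
  "scattered emb U \<longleftrightarrow>
     module.subspace (sub_scale emb) U \<and>
     (\<forall>L. vec.subspace L \<and> vec.dim L = 1 \<longrightarrow> vector_space.dim (sub_scale emb) (U \<inter> L) \<le> 1)"

definition U_set :: "nat \<Rightarrow> nat \<Rightarrow> nat \<Rightarrow> 'a::field \<Rightarrow> 'a \<Rightarrow> 'a \<Rightarrow> ('a ^ 6) set" where
  "U_set q I J \<alpha> \<beta> \<gamma> =
     {vector [x, y, z,
              x ^ (q ^ I) + \<alpha> * y ^ (q ^ J),
              x ^ (q ^ J) + \<beta> * z ^ (q ^ I),
              y ^ (q ^ I) + \<gamma> * z ^ (q ^ J)] | x y z. True}"

lemma vector_6 [simp]:
  "(vector [a, b, c, d, e, f] :: 'a::zero ^ 6) $ 1 = a"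
  "(vector [a, b, c, d, e, f] :: 'a::zero ^ 6) $ 2 = b"
  "(vector [a, b, c, d, e, f] :: 'a::zero ^ 6) $ 3 = c"
  "(vector [a, b, c, d, e, f] :: 'a::zero ^ 6) $ 4 = d"
  "(vector [a, b, c, d, e, f] :: 'a::zero ^ 6) $ 5 = e"
  "(vector [a, b, c, d, e, f] :: 'a::zero ^ 6) $ 6 = f"
  unfolding vector_def by simp_all

definition admissible :: "nat \<Rightarrow> nat \<Rightarrow> 'a::field \<Rightarrow> 'a \<Rightarrow> 'a \<Rightarrow> bool" where
  "admissible q K \<alpha> \<beta> \<gamma> \<longleftrightarrow>
     \<alpha> \<noteq> 0 \<and> \<beta> \<noteq> 0 \<and> \<gamma> \<noteq> 0 \<and>
     \<not> is_nth_power (q ^ (2 * K) + q ^ K + 1) (\<alpha> * \<gamma> ^ (q ^ K) * \<beta> ^ (q ^ K + 1))"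

definition GammaL_equiv :: "('a::field ^ 'm) set \<Rightarrow> ('a ^ 'm) set \<Rightarrow> bool" where
  "GammaL_equiv U U' \<longleftrightarrow>
     (\<exists>(M :: 'a ^ 'm ^ 'm) s. invertible M \<and> field_aut s \<and>
        U' = (\<lambda>u. M *v (\<chi> i. s (u $ i))) ` U)"

end

theory Submission
  imports Defs "HOL-Number_Theory.Residues"
begin

text \<open>
  Comparing coefficients of linearised polynomials of degree less than \<open>q ^ n\<close> (this is where
  \<open>2 * J < n\<close> enters) forces the upper right 3x3 block of a matrix mapping \<open>U_set q I J \<alpha> \<beta> \<gamma>\<close> to
  \<open>U_set q I J \<alpha>' \<beta>' \<gamma>'\<close> to vanish. According to which entry of its first row is nonzero, the
  upper left block then contains an invertible diagonal or cyclically permuted diagonal part, and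
  \<open>(\<alpha>', \<beta>', \<gamma>')\<close> lies in one of three orbits of the torus of triples \<open>(a, b, c)\<close> acting by
  \<open>(a ^ k / b ^ l, a ^ l / c ^ k, b ^ k / c ^ l)\<close> with \<open>k = q ^ I\<close> and \<open>l = q ^ J\<close>. The stabilisers are parametrised by the
  \<open>gcd (q ^ (3 * K) - 1) (q ^ n - 1)\<close> roots of unity of that order, so an equivalence class covers
  at most \<open>3 * n * h\<close> orbits of known size, and dividing the number of admissible triples by this
  gives the bound.
\<close>

section \<open>Finite fields\<close>

hide_const (open) up_ring.coeff up_ring.monom

section \<open>Fermat's identity and Frobenius maps\<close>

text \<open>Multiplication by \<open>x\<close> permutes the nonzero elements, so their product
  equals itself times \<open>x ^ (CARD('a) - 1)\<close>.\<close>

lemma power_card_minus_1: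
  fixes x :: "'a::{finite,field}"
  assumes "x \<noteq> 0"
  shows "x ^ (CARD('a) - 1) = 1"
proof -
  have "(\<Prod>y\<in>UNIV - {0}. x * y) = (\<Prod>y\<in>UNIV - {0}. y)"
    by (rule prod.reindex_bij_witness[of _ "\<lambda>y. y / x" "\<lambda>y. x * y"]) (use assms in auto)
  moreover have "(\<Prod>y\<in>UNIV - {0}. x * y) = x ^ (CARD('a) - 1) * (\<Prod>y\<in>UNIV - {0}. y)"
    by (simp add: prod.distrib card_Diff_singleton)
  ultimately show ?thesis
    by simp
qed

lemma power_card:
  fixes x :: "'a::{finite,field}"
  shows "x ^ CARD('a) = x"
proof (cases "x = 0")
  case False
  have "x ^ CARD('a) = x * x ^ (CARD('a) - 1)"
    by (metis One_nat_def Suc_pred power_Suc zero_less_card_finite)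
  then show ?thesis
    using power_card_minus_1[OF False] by simp
qed (simp add: power_0_left)

lemma CHAR_eq_of_card:
  assumes "prime p" "CARD('a::{finite,field}) = p ^ m"
  shows "CHAR('a) = p"
proof -
  have "prime CHAR('a)"
    by (intro prime_CHAR_semidom finite_imp_CHAR_pos) simp
  moreover have "CHAR('a) dvd p ^ m"
    using CHAR_dvd_CARD[where ?'a = 'a] assms(2) by simp
  ultimately show ?thesis
    using assms(1) prime_dvd_power primes_dvd_imp_eq by blast
qed

lemma frobenius_add:
  fixes x y :: "'a::{finite,field}"
  assumes "prime p" "CARD('a) = p ^ m"
  shows "(x + y) ^ (p ^ k) = x ^ (p ^ k) + y ^ (p ^ k)"
  using CHAR_eq_of_card[OF assms] assms(1) by (intro freshmans_dream'[of _ k]) auto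

lemma frobenius_diff:
  fixes x y :: "'a::{finite,field}"
  assumes "prime p" "CARD('a) = p ^ m"
  shows "(x - y) ^ (p ^ k) = x ^ (p ^ k) - y ^ (p ^ k)"
  using frobenius_add[OF assms, of "x - y" y k] by (simp add: algebra_simps)

lemma frobenius_surj:
  fixes x :: "'a::{finite,field}"
  assumes "prime p" "CARD('a) = p ^ m"
  obtains y where "y ^ (p ^ k) = x"
proof -
  have "inj (\<lambda>x::'a. x ^ (p ^ k))"
    by (rule injI) (metis assms frobenius_diff power_not_zero right_minus_eq)
  then have "surj (\<lambda>x::'a. x ^ (p ^ k))"
    by (simp add: finite_UNIV_inj_surj)
  then show ?thesis
    using that by (metis surjD)
qed

section \<open>Roots of unity, generators and linearised polynomials\<close>

lemma card_roots_of_unity_le: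
  assumes "k > 0"
  shows "card {x::'a::{finite,field}. x ^ k = 1} \<le> k"
proof -
  let ?P = "monom (1::'a) k - 1"
  have "coeff ?P k = 1"
    using assms by simp
  then have "?P \<noteq> 0"
    by (metis coeff_0 zero_neq_one)
  then have "card {x. poly ?P x = 0} \<le> degree ?P"
    by (rule card_poly_roots_bound)
  also have "\<dots> \<le> k"
    by (intro degree_diff_le) (simp_all add: degree_monom_le)
  finally show ?thesis
    by (simp add: poly_monom)
qed

text \<open>Nonzero solutions satisfy \<open>x ^ (k - 1) = 1\<close>; zero contributes one
  more.\<close>

lemma card_power_eq_self_le:
  assumes "k > 1"
  shows "card {x::'a::{finite,field}. x ^ k = x} \<le> k"
proof -
  have "x ^ (k - 1) = 1" if "x \<noteq> 0" "x ^ k = x" for x :: 'a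
  proof -
    have "x * x ^ (k - 1) = x * 1"
      using that assms by (simp flip: power_Suc)
    then show ?thesis
      using that(1) by (metis mult_left_cancel)
  qed
  then have "card {x::'a. x ^ k = x} \<le> card (insert 0 {x::'a. x ^ (k - 1) = 1})"
    by (intro card_mono) auto
  also have "\<dots> \<le> Suc (card {x::'a. x ^ (k - 1) = 1})"
    by (rule card_insert_le_m1) simp_all
  also have "\<dots> \<le> k"
    using card_roots_of_unity_le[of "k - 1", where ?'a = 'a] assms by simp
  finally show ?thesis .
qed

text \<open>With \<open>N = CARD('a) - 1\<close>, all \<open>N\<close> roots of \<open>X ^ N - 1\<close> are in the field, so its divisor
  \<open>X ^ k - 1\<close> cannot have fewer than \<open>k\<close> roots.\<close>

lemma card_roots_of_unity_ge:
  assumes "k dvd CARD('a::{finite,field}) - 1"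
  shows "k \<le> card {x::'a. x ^ k = 1}"
proof -
  let ?N = "CARD('a) - 1"
  have "card {0, 1::'a} \<le> CARD('a)"
    by (rule card_mono) auto
  then have N: "?N > 0"
    by simp
  obtain l where l: "?N = k * l"
    using assms by blast
  have kl: "k > 0" "l > 0"
    using N unfolding l by simp_all
  \<comment> \<open>\<open>H\<close> is the cofactor of \<open>X ^ k - 1\<close> in
    \<open>X ^ (k * l) - 1\<close>, a geometric sum in \<open>X ^ k\<close>.\<close>
  define H where "H = (\<Sum>i<l. monom (1::'a) (k * i))"
  have H: "poly H x = (\<Sum>i<l. (x ^ k) ^ i)" for x
    by (simp add: H_def poly_sum poly_monom power_mult)
  have "coeff H 0 = 1"
    using kl by (simp add: H_def coeff_sum coeff_monom if_distrib sum.delta cong: if_cong)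
  then have "H \<noteq> 0"
    by auto
  have "degree H \<le> k * (l - 1)"
    unfolding H_def by (intro degree_sum_le) (auto intro!: order.trans[OF degree_monom_le] mult_le_mono2)
  then have *: "card {x. poly H x = 0} \<le> ?N - k"
    using card_poly_roots_bound[OF \<open>H \<noteq> 0\<close>] l by (simp add: algebra_simps)
  have "x ^ k = 1 \<or> poly H x = 0" if "x \<noteq> 0" for x
  proof -
    have "(x ^ k) ^ l = 1"
      using power_card_minus_1[OF that] unfolding l power_mult .
    then show ?thesis
      using power_diff_1_eq[of "x ^ k" l] H[of x] by simp
  qed
  then have "UNIV - {0} \<subseteq> {x::'a. x ^ k = 1} \<union> {x. poly H x = 0}"
    by auto
  then have "?N \<le> card ({x::'a. x ^ k = 1} \<union> {x. poly H x = 0})"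
    using card_mono[of "{x::'a. x ^ k = 1} \<union> {x. poly H x = 0}" "UNIV - {0}"] by simp
  also have "\<dots> \<le> card {x::'a. x ^ k = 1} + card {x. poly H x = 0}"
    by (rule card_Un_le)
  finally have "?N \<le> card {x::'a. x ^ k = 1} + (?N - k)"
    using * by linarith
  moreover have "k \<le> ?N"
    using l kl by simp
  ultimately show ?thesis
    by linarith
qed

text \<open>Cyclicity of the multiplicative group is known for fields given by a carrier, so the
  type is packaged as the record \<open>R\<close>.\<close>

lemma finite_field_has_generator:
  obtains g :: "'a::{finite,field}" where "g \<noteq> 0" "\<And>x. x \<noteq> 0 \<Longrightarrow> \<exists>i::nat. x = g ^ i"
proof -
  define R :: "'a ring"
    where "R = \<lparr>carrier = UNIV, monoid.mult = (*), one = 1, ring.zero = 0, add = (+)\<rparr>"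
  have "\<exists>y. x + y = 0" for x :: 'a
    by (rule exI[of _ "- x"]) simp
  moreover have "x \<noteq> 0 \<Longrightarrow> \<exists>y. x * y = 1" for x :: 'a
    by (rule exI[of _ "inverse x"]) auto
  ultimately interpret R: Ring.field R
    unfolding R_def
    by unfold_locales (auto simp: algebra_simps Units_def)
  have pow: "x [^]\<^bsub>R\<^esub> (i::nat) = x ^ i" for x i
    by (induction i) (simp_all add: R_def)
  have carrier: "carrier (mult_of R) = UNIV - {0}"
    by (simp add: R_def mult_of_def)
  have "finite (carrier R)"
    by (simp add: R_def)
  note R.finite_field_mult_group_has_gen[OF this, unfolded nat_pow_mult_of pow carrier]
  then obtain g :: 'a where g: "g \<in> UNIV - {0}" "UNIV - {0} = {g ^ i | i::nat. i \<in> UNIV}"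
    by blast
  show ?thesis
  proof (rule that[of g])
    fix x :: 'a
    assume "x \<noteq> 0"
    then have "x \<in> UNIV - {0}"
      by simp
    then show "\<exists>i::nat. x = g ^ i"
      unfolding g(2) by auto
  qed (use g(1) in simp)
qed

text \<open>The polynomial has degree at most \<open>q ^ (n - 1)\<close> but would have all
  \<open>q ^ n\<close> field elements as roots.\<close>

lemma linearised_coeffs_eq_0:
  fixes f :: "nat \<Rightarrow> 'a::{finite,field}"
  assumes "q > 1" "CARD('a) = q ^ n"
    and zero: "\<And>x. (\<Sum>k<n. f k * x ^ (q ^ k)) = 0" and "k < n"
  shows "f k = 0"
proof -
  define P where "P = (\<Sum>k<n. monom (f k) (q ^ k))"
  have "coeff P (q ^ k) = f k"
    using assms by (simp add: P_def coeff_sum coeff_monom if_distrib cong: if_cong)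
  moreover have "P = 0"
  proof (rule ccontr)
    assume "P \<noteq> 0"
    have "poly P x = 0" for x
      using zero[of x] by (simp add: P_def poly_sum poly_monom)
    then have "CARD('a) \<le> degree P"
      using card_poly_roots_bound[OF \<open>P \<noteq> 0\<close>] by simp
    also have "degree P \<le> q ^ (n - 1)"
      unfolding P_def using assms
      by (intro degree_sum_le) (auto intro!: order.trans[OF degree_monom_le] power_increasing)
    also have "\<dots> < q ^ n"
      using assms by (intro power_strict_increasing) auto
    finally show False
      using assms by simp
  qed
  ultimately show ?thesis
    by simp
qed

section \<open>The prime field and field automorphisms\<close>

text \<open>\<open>X ^ p - X\<close> has at most \<open>p\<close> roots, and the images of
  \<open>0, ..., p - 1\<close> are already \<open>p\<close> of them.\<close>

lemma frobenius_fixed_imp_of_nat: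
  fixes c :: "'a::{finite,field}"
  assumes "prime p" "CHAR('a) = p" "c ^ p = c"
  shows "\<exists>k. c = of_nat k"
proof -
  let ?A = "of_nat ` {..<p} :: 'a set"
  have "p > 1"
    using assms(1) prime_gt_1_nat by blast
  then have "card {x::'a. x ^ p = x} \<le> p"
    by (rule card_power_eq_self_le)
  moreover have "card ?A = p"
  proof -
    have "inj_on (of_nat :: nat \<Rightarrow> 'a) {..<p}"
      by (rule inj_onI) (use assms(2) in \<open>auto simp: of_nat_eq_iff_cong_CHAR cong_less_modulus_unique_nat\<close>)
    then show ?thesis
      by (simp add: card_image)
  qed
  moreover have "?A \<subseteq> {x. x ^ p = x}"
  proof -
    have fixed: "(of_nat k :: 'a) ^ p = of_nat k" for k
    proof (induction k)
      case 0
      then show ?case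
        using \<open>p > 1\<close> by (simp add: power_0_left)
    next
      case (Suc k)
      have "(1 + of_nat k :: 'a) ^ p = 1 ^ p + of_nat k ^ p"
        by (rule freshmans_dream) (use assms(1,2) in simp_all)
      then show ?case
        by (simp add: Suc.IH)
    qed
    then show ?thesis
      by (simp add: image_subset_iff)
  qed
  ultimately have "?A = {x. x ^ p = x}"
    by (intro card_seteq) simp_all
  then show ?thesis
    using assms(3) by blast
qed

lemma field_hom_0: "field_hom s \<Longrightarrow> s 0 = 0"
  unfolding field_hom_def by (metis add_cancel_right_right)

lemma field_hom_power: "field_hom s \<Longrightarrow> s (x ^ k) = s x ^ k"
  by (induction k) (auto simp: field_hom_def)

lemma field_hom_of_nat: "field_hom s \<Longrightarrow> s (of_nat k) = of_nat k"
  by (induction k) (auto simp: field_hom_def field_hom_0)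

lemma field_hom_sum: "field_hom s \<Longrightarrow> s (sum f A) = (\<Sum>x\<in>A. s (f x))"
  by (induction A rule: infinite_finite_induct) (auto simp: field_hom_def field_hom_0)

lemma field_hom_inj:
  assumes "field_hom s"
  shows "inj s"
proof (rule injI)
  fix x y
  assume "s x = s y"
  have add: "s (x - y) + s y = s x"
    using assms by (metis diff_add_cancel field_hom_def)
  show "x = y"
  proof (rule ccontr)
    assume "x \<noteq> y"
    then have "s (x - y) * s (inverse (x - y)) = 1"
      using assms by (metis field_hom_def right_inverse right_minus_eq)
    then show False
      using add \<open>s x = s y\<close> by simp
  qed
qed

lemma field_hom_nonzero:
  assumes "field_hom s" "x \<noteq> 0"
  shows "s x \<noteq> 0"
  using field_hom_inj[OF assms(1)] field_hom_0[OF assms(1)] assms(2) by (metis injD)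

text \<open>The conjugates \<open>g ^ (p ^ i)\<close> of a generator \<open>g\<close> are the roots of a polynomial over the
  prime field, which an automorphism permutes; and an automorphism is determined by its value
  at \<open>g\<close>.\<close>

lemma card_field_aut_le:
  assumes p: "prime p" and card: "CARD('a::{finite,field}) = p ^ m"
  shows "card {s :: 'a \<Rightarrow> 'a. field_aut s} \<le> m"
proof -
  obtain g :: 'a where g: "g \<noteq> 0" "\<And>x. x \<noteq> 0 \<Longrightarrow> \<exists>i::nat. x = g ^ i"
    using finite_field_has_generator by blast
  have "p > 1"
    using p prime_gt_1_nat by blast
  have "m > 0"
  proof (rule ccontr)
    assume "\<not> m > 0"
    moreover have "card {0, 1::'a} \<le> CARD('a)"
      by (rule card_mono) auto
    ultimately show False
      using card by simp
  qed
  define P where "P = (\<Prod>i<m. [:- (g ^ (p ^ i)), 1:])"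
  have "degree P \<le> m"
    unfolding P_def using degree_prod_sum_le[of "{..<m}" "\<lambda>i. [:- (g ^ (p ^ i)), 1:]"] by simp
  then have poly_P: "poly P x = (\<Sum>i\<le>m. coeff P i * x ^ i)" for x
    by (subst poly_as_sum_of_monoms'[symmetric]) (simp_all add: poly_sum poly_monom)
  have prod_P: "poly P x = (\<Prod>i<m. x - g ^ (p ^ i))" for x
    by (simp add: P_def poly_prod)
  have shift: "poly P (x ^ p) = poly P x ^ p" for x
  proof -
    obtain m' where m': "m = Suc m'"
      using \<open>m > 0\<close> gr0_conv_Suc by auto
    have "poly P x ^ p = (\<Prod>i<m. x ^ p - g ^ (p ^ Suc i))"
      using frobenius_diff[OF p card, of x _ 1]
      by (simp add: prod_P prod_power_distrib mult.commute[of p] flip: power_mult)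
    \<comment> \<open>The last conjugate wraps around, \<open>g ^ (p ^ m) = g\<close>, so the linear
      factors are permuted cyclically.\<close>
    also have "\<dots> = (\<Prod>i<m'. x ^ p - g ^ (p ^ Suc i)) * (x ^ p - g ^ (p ^ 0))"
      using power_card[of g] card m' by simp
    also have "\<dots> = poly P (x ^ p)"
      unfolding prod_P m' prod.lessThan_Suc_shift by (simp add: mult.commute)
    finally show ?thesis ..
  qed
  have coeff_fixed: "coeff P i ^ p = coeff P i" for i
  proof -
    \<comment> \<open>\<open>D\<close> is the polynomial whose coefficients are those of
      \<open>P\<close> raised to the power \<open>p\<close>, minus \<open>P\<close>. It vanishes at
      every \<open>x = y ^ p\<close>, hence everywhere, but has degree at most
      \<open>m < p ^ m\<close>.\<close>
    define D where "D = (\<Sum>i\<le>m. monom (coeff P i ^ p - coeff P i) i)"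
    have "poly D x = 0" for x
    proof -
      obtain y where y: "y ^ p = x"
        using frobenius_surj[OF p card, of 1 x] by auto
      have "poly P y ^ p = (\<Sum>i\<le>m. (coeff P i * y ^ i) ^ p)"
        unfolding poly_P by (rule freshmans_dream_sum) (use CHAR_eq_of_card[OF p card] p in simp_all)
      also have "\<dots> = (\<Sum>i\<le>m. coeff P i ^ p * x ^ i)"
        unfolding y[symmetric] by (simp add: power_mult_distrib mult.commute flip: power_mult)
      finally have "poly P y ^ p = (\<Sum>i\<le>m. coeff P i ^ p * x ^ i)" .
      then show ?thesis
        using shift[of y]
        by (simp add: y poly_P D_def poly_sum poly_monom left_diff_distrib sum_subtractf)
    qed
    moreover have "degree D < CARD('a)"
    proof -
      have "degree D \<le> m"
        unfolding D_def by (intro degree_sum_le) (auto intro!: order.trans[OF degree_monom_le])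
      then show ?thesis
        using card \<open>p > 1\<close> power_gt_expt[of p m] by simp
    qed
    ultimately have "D = 0"
      using card_poly_roots_bound[of D] by fastforce
    moreover have "coeff D i = coeff P i ^ p - coeff P i"
      using \<open>degree P \<le> m\<close> coeff_eq_0[of P i] \<open>p > 1\<close>
      by (cases "i \<le> m") (auto simp: D_def coeff_sum if_distrib cong: if_cong)
    ultimately show ?thesis
      by simp
  qed
  have root: "s g \<in> (\<lambda>i. g ^ (p ^ i)) ` {..<m}" if "field_hom s" for s
  proof -
    have "poly P g = 0"
      using \<open>m > 0\<close> by (auto simp: prod_P intro!: bexI[of _ 0])
    have "s (coeff P i) = coeff P i" for i
      using frobenius_fixed_imp_of_nat[OF p CHAR_eq_of_card[OF p card] coeff_fixed[of i]]
        field_hom_of_nat[OF that] by metis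
    then have "s (poly P g) = poly P (s g)"
      using that by (simp add: poly_P field_hom_sum field_hom_power field_hom_def)
    then have "poly P (s g) = 0"
      using \<open>poly P g = 0\<close> field_hom_0[OF that] by simp
    then show ?thesis
      by (auto simp: prod_P)
  qed
  have "inj_on (\<lambda>s. s g) {s :: 'a \<Rightarrow> 'a. field_aut s}"
  proof (rule inj_onI, rule ext)
    fix s t :: "'a \<Rightarrow> 'a" and x
    assume st: "s \<in> {s. field_aut s}" "t \<in> {s. field_aut s}" "s g = t g"
    then show "s x = t x"
      by (cases "x = 0") (use g(2)[of x] in \<open>auto simp: field_aut_def field_hom_0 field_hom_power\<close>)
  qed
  then have "card {s :: 'a \<Rightarrow> 'a. field_aut s} = card ((\<lambda>s. s g) ` {s :: 'a \<Rightarrow> 'a. field_aut s})"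
    by (simp add: card_image)
  also have "\<dots> \<le> card ((\<lambda>i. g ^ (p ^ i)) ` {..<m})"
    using root by (intro card_mono) (auto simp: field_aut_def)
  also have "\<dots> \<le> m"
    using card_image_le[of "{..<m}" "\<lambda>i. g ^ (p ^ i)"] by simp
  finally show ?thesis .
qed

section \<open>The sets \<open>U_set\<close> over a finite field\<close>

text \<open>The injective image of \<open>emb\<close> supplies \<open>CARD('k)\<close> solutions,
  and there are no more than that.\<close>

lemma fixed_field_eq_range:
  fixes emb :: "'k::{finite,field} \<Rightarrow> 'a::{finite,field}"
  assumes "field_hom emb"
  shows "{x. x ^ CARD('k) = x} = range emb"
proof -
  have "card {0, 1::'k} \<le> CARD('k)"
    by (rule card_mono) auto
  then have "card {x::'a. x ^ CARD('k) = x} \<le> card (range emb)"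
    using card_power_eq_self_le[of "CARD('k)", where ?'a = 'a]
    by (simp add: card_image[OF field_hom_inj[OF assms]])
  moreover have "range emb \<subseteq> {x. x ^ CARD('k) = x}"
    using field_hom_power[OF assms, of _ "CARD('k)"] power_card[where ?'a = 'k] by auto
  ultimately show ?thesis
    using card_seteq[of "{x. x ^ CARD('k) = x}" "range emb"] by simp
qed

section \<open>Coordinates in dimension six\<close>

lemma exhaust_6:
  fixes x :: 6
  shows "x = 1 \<or> x = 2 \<or> x = 3 \<or> x = 4 \<or> x = 5 \<or> x = 6"
proof (induct x)
  case (of_int z)
  then have "z = 0 \<or> z = 1 \<or> z = 2 \<or> z = 3 \<or> z = 4 \<or> z = 5"
    by fastforce
  then show ?case
    by auto
qed

lemma forall_6: "(\<forall>i::6. P i) \<longleftrightarrow> P 1 \<and> P 2 \<and> P 3 \<and> P 4 \<and> P 5 \<and> P 6"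
  by (metis exhaust_6)

lemma UNIV_6: "UNIV = {1, 2, 3, 4, 5, 6::6}"
  using exhaust_6 by auto

lemma sum_6: "sum f (UNIV::6 set) = f 1 + f 2 + f 3 + f 4 + f 5 + f 6"
  unfolding UNIV_6 by (simp add: ac_simps)

lemma U_set_iff:
  "u \<in> U_set q I J \<alpha> \<beta> \<gamma> \<longleftrightarrow> u $ 4 = (u $ 1) ^ (q ^ I) + \<alpha> * (u $ 2) ^ (q ^ J) \<and>
    u $ 5 = (u $ 1) ^ (q ^ J) + \<beta> * (u $ 3) ^ (q ^ I) \<and>
    u $ 6 = (u $ 2) ^ (q ^ I) + \<gamma> * (u $ 3) ^ (q ^ J)"
  by (auto simp: U_set_def vec_eq_iff forall_6)

text \<open>Every set lies in its own class; this turns an equality of classes into an equivalence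
  when fibres are bounded.\<close>

lemma GammaL_equiv_refl: "GammaL_equiv (U :: ('a::field ^ 'm) set) U"
proof -
  have "invertible (mat 1 :: 'a ^ 'm ^ 'm)"
    unfolding invertible_def by (metis matrix_mul_lid)
  moreover have "field_aut id"
    by (simp add: field_aut_def field_hom_def)
  ultimately show ?thesis
    unfolding GammaL_equiv_def by (intro exI[of _ "mat 1"] exI[of _ id]) simp
qed

section \<open>Torus orbits and counting by fibres\<close>

text \<open>With \<open>k = q ^ I\<close> and \<open>l = q ^ J\<close>, these are the parameters
  that result from rescaling x, y, z by nonzero \<open>a\<close>, \<open>b\<close>,
  \<open>c\<close>.\<close>

definition torus_orbit :: "nat \<Rightarrow> nat \<Rightarrow> 'a::field \<times> 'a \<times> 'a \<Rightarrow> ('a \<times> 'a \<times> 'a) set" where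
  "torus_orbit k l = (\<lambda>(\<alpha>, \<beta>, \<gamma>).
     (\<lambda>(a, b, c). (\<alpha> * a ^ k / b ^ l, \<beta> * a ^ l / c ^ k, \<gamma> * b ^ k / c ^ l)) `
       ((- {0}) \<times> (- {0}) \<times> (- {0})))"

lemma torus_orbitI:
  assumes "a \<noteq> 0" "b \<noteq> 0" "c \<noteq> 0"
    and "\<alpha>' = \<alpha> * a ^ k / b ^ l" "\<beta>' = \<beta> * a ^ l / c ^ k" "\<gamma>' = \<gamma> * b ^ k / c ^ l"
  shows "(\<alpha>', \<beta>', \<gamma>') \<in> torus_orbit k l (\<alpha>, \<beta>, \<gamma>)"
  using assms by (auto simp: torus_orbit_def image_iff intro!: bexI[of _ "(a, b, c)"])

lemma card_image_mult_le:
  assumes "finite A" "\<And>x. x \<in> A \<Longrightarrow> k \<le> card {y \<in> A. f y = f x}"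
  shows "card (f ` A) * k \<le> card A"
proof -
  have "card (f ` A) * k \<le> (\<Sum>z\<in>f ` A. card {y \<in> A. f y = z})"
    using assms(2) by (intro sum_bounded_below[where K = k, simplified]) auto
  also have "\<dots> = card A"
    using sum.image_gen[OF assms(1), of "\<lambda>_. 1::nat" f] by simp
  finally show ?thesis .
qed

lemma card_le_card_image_mult:
  assumes "finite A" "\<And>x. x \<in> A \<Longrightarrow> card {y \<in> A. f y = f x} \<le> k"
  shows "card A \<le> card (f ` A) * k"
proof -
  have "card A = (\<Sum>z\<in>f ` A. card {y \<in> A. f y = z})"
    using sum.image_gen[OF assms(1), of "\<lambda>_. 1::nat" f] by simp
  also have "\<dots> \<le> card (f ` A) * k"
    using assms(2) by (intro sum_bounded_above[where K = k, simplified]) auto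
  finally show ?thesis .
qed

section \<open>Frobenius exponents in the extension field\<close>

text \<open>The argument \<open>F\<close> makes the field type a parameter, to be instantiated by
  \<open>TYPE('a)\<close>.\<close>

locale fq_extension =
  fixes p h q n :: nat and F :: "'a::{finite,field} itself"
  assumes prime_p: "prime p" and h_pos: "h \<ge> 1" and q_eq: "q = p ^ h"
    and n_pos: "n \<ge> 1" and card_F: "CARD('a) = q ^ n"
begin

lemma q_gt_1: "q > 1"
  using one_less_power[of p h] prime_gt_1_nat[OF prime_p] h_pos by (simp add: q_eq)

lemma q_pos [simp]: "q > 0" "q \<noteq> 0"
  using q_gt_1 by simp_all

lemma card_F': "CARD('a) = p ^ (h * n)"
  by (simp add: card_F q_eq power_mult)

lemma frob_add: "(x + y :: 'a) ^ (q ^ k) = x ^ (q ^ k) + y ^ (q ^ k)"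
  using frobenius_add[OF prime_p card_F', of x y "h * k"] by (simp add: q_eq power_mult)

lemma frob_inj: "(x :: 'a) ^ (q ^ k) = y ^ (q ^ k) \<longleftrightarrow> x = y"
  using frobenius_diff[OF prime_p card_F', of x y "h * k"]
  by (auto simp: q_eq power_mult)

lemma frob_surj:
  obtains y :: 'a where "y ^ (q ^ k) = x"
  using frobenius_surj[OF prime_p card_F', of "h * k" x] by (auto simp: q_eq power_mult)

lemma frob_fixed_mult:
  assumes "(x :: 'a) ^ (q ^ a) = x"
  shows "x ^ (q ^ (a * k)) = x"
  using assms by (induction k) (simp_all add: power_add power_mult)

text \<open>Euclid's algorithm on exponents: an element fixed for \<open>a\<close> and
  \<open>b\<close> is also fixed for \<open>a mod b\<close>.\<close>

lemma frob_fixed_gcd: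
  assumes "(x :: 'a) ^ (q ^ a) = x" "x ^ (q ^ b) = x"
  shows "x ^ (q ^ gcd a b) = x"
  using assms
proof (induction a b rule: gcd_nat_induct)
  case (step a b)
  have "x ^ (q ^ a) = x ^ (q ^ (b * (a div b) + a mod b))"
    by simp
  also have "\<dots> = x ^ (q ^ (a mod b))"
    unfolding power_add power_mult[of x] frob_fixed_mult[OF step.prems(2)] ..
  finally have "x ^ (q ^ gcd b (a mod b)) = x"
    using step by metis
  then show ?case
    by (subst gcd_red_nat)
qed simp

section \<open>Scatteredness\<close>

text \<open>The exponent \<open>n\<close> fixes every field element, so the exponent
  \<open>gcd I (gcd J n) = 1\<close> fixes \<open>l\<close>.\<close>

lemma frob_fixed_imp_fixed:
  assumes "gcd I (gcd J n) = 1" "(l :: 'a) ^ (q ^ I) = l" "l ^ (q ^ J) = l"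
  shows "l ^ q = l"
  using frob_fixed_gcd[OF assms(2) frob_fixed_gcd[OF assms(3), of n]] assms(1)
    power_card[of l] card_F by simp

text \<open>If \<open>u\<close> and \<open>l *s u\<close> are both in \<open>U_set\<close>, then with \<open>A = l\<^sup>I - l\<close>, \<open>B = l\<^sup>J - l\<close> and
  \<open>s = - B / A\<close> (the superscripts being Frobenius exponents) the defining equations give
  \<open>x\<^sup>I = \<alpha> s y\<^sup>J\<close>, \<open>\<beta> z\<^sup>I = s x\<^sup>J\<close> and \<open>y\<^sup>I = \<gamma> s z\<^sup>J\<close>; eliminating \<open>x\<close> and \<open>y\<close> exhibits the
  forbidden power.\<close>

lemma not_admissible_of_cycle:
  assumes J: "J = I + K"
    and nz: "(x :: 'a) \<noteq> 0" "y \<noteq> 0" "z \<noteq> 0" "\<beta> \<noteq> 0" "s \<noteq> 0"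
    and x: "x ^ (q ^ I) = \<alpha> * s * y ^ (q ^ J)"
    and z: "\<beta> * z ^ (q ^ I) = s * x ^ (q ^ J)"
    and y: "y ^ (q ^ I) = \<gamma> * s * z ^ (q ^ J)"
  shows "\<not> admissible q K \<alpha> \<beta> \<gamma>"
proof -
  define Q where "Q = q ^ K"
  define d where "d = Q ^ 2 + Q + 1"
  define w where "w = \<alpha> * \<gamma> ^ Q * \<beta> ^ (Q + 1)"
  define Z where "Z = z ^ (q ^ I)"
  obtain r where r: "Q = Suc r"
    using zero_less_power[OF q_pos(1), of K] unfolding Q_def by (metis gr0_conv_Suc)
  have shift: "v ^ (q ^ J) = (v ^ (q ^ I)) ^ Q" for v :: 'a
    by (simp add: J Q_def power_add power_mult)
  have y_J: "y ^ (q ^ J) = \<gamma> ^ Q * s ^ Q * Z ^ (Q ^ 2)"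
    by (simp add: shift y Z_def power_mult_distrib power2_eq_square mult.assoc flip: power_mult)
  have x_J: "x ^ (q ^ J) = \<alpha> ^ Q * s ^ Q * (\<gamma> ^ Q * s ^ Q * Z ^ (Q ^ 2)) ^ Q"
    using y_J by (simp add: shift[of x] x power_mult_distrib)
  have "\<beta> * Z = s * (\<alpha> ^ Q * s ^ Q * (\<gamma> ^ Q * s ^ Q * Z ^ (Q ^ 2)) ^ Q)"
    using z x_J by (simp add: Z_def)
  \<comment> \<open>The exponent \<open>d\<close> arises from
    \<open>Q ^ 3 - 1 = (Q - 1) * d\<close>, with \<open>r = Q - 1\<close>.\<close>
  moreover have "Z ^ (Q ^ 2 * Q) = Z * (Z ^ r) ^ d"
    unfolding power_mult[symmetric] power_Suc[symmetric] by (rule arg_cong[of _ _ "power Z"])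
      (simp add: r d_def power2_eq_square algebra_simps)
  ultimately have "\<beta> * Z = s ^ d * (\<alpha> ^ Q * \<gamma> ^ (Q * Q)) * (Z * (Z ^ r) ^ d)"
    by (simp add: d_def power_mult_distrib power_add power2_eq_square mult_ac flip: power_mult)
  moreover have "Z \<noteq> 0"
    using nz by (simp add: Z_def)
  ultimately have "\<beta> = (s * Z ^ r) ^ d * (\<alpha> ^ Q * \<gamma> ^ (Q * Q))"
    by (simp add: power_mult_distrib)
  \<comment> \<open>Multiplying by \<open>\<beta> ^ (Q * Q + Q)\<close> completes the factor on the
    right to \<open>w ^ Q\<close>.\<close>
  then have "\<beta> ^ d = (s * Z ^ r) ^ d * (\<alpha> ^ Q * \<gamma> ^ (Q * Q)) * \<beta> ^ (Q * Q + Q)"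
    by (metis d_def power2_eq_square add_eq_if mult.commute One_nat_def Suc_eq_plus1 power_Suc)
  then have "\<beta> ^ d = (s * Z ^ r) ^ d * w ^ Q"
    by (simp add: w_def power_mult_distrib power_add mult_ac flip: power_mult)
  then have "w ^ Q = (\<beta> / (s * Z ^ r)) ^ d"
    using nz \<open>Z \<noteq> 0\<close> by (simp add: power_divide field_simps)
  \<comment> \<open>Taking a \<open>Q\<close>-th root inside the \<open>d\<close>-th power makes
    both sides \<open>Q\<close>-th powers, so that injectivity of Frobenius applies.\<close>
  moreover obtain e where "e ^ (q ^ K) = \<beta> / (s * Z ^ r)"
    using frob_surj by blast
  ultimately have "w ^ Q = (e ^ d) ^ Q"
    by (metis Q_def mult.commute power_mult)
  then have "w = e ^ d"
    by (simp add: Q_def frob_inj)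
  then have "is_nth_power d w"
    unfolding is_nth_power_def by blast
  moreover have "d = q ^ (2 * K) + q ^ K + 1"
    by (simp add: d_def Q_def mult.commute flip: power_mult)
  ultimately show ?thesis
    by (simp add: admissible_def w_def Q_def)
qed

text \<open>The hypotheses say that x, y, z solve a homogeneous system with coefficients
  \<open>A\<close> and \<open>B\<close>. Nonzero \<open>A\<close> would give the cycle of equations
  excluded by admissibility, so \<open>l\<close> is fixed by both Frobenius exponents.\<close>

lemma eigenvalue_fixed:
  assumes IJ: "I < J" and gcd: "gcd I (gcd J n) = 1"
    and adm: "admissible q (J - I) \<alpha> \<beta> \<gamma>"
    and nz: "(x :: 'a) \<noteq> 0 \<or> y \<noteq> 0 \<or> z \<noteq> 0"
    and e1: "l * (x ^ (q ^ I) + \<alpha> * y ^ (q ^ J)) = (l * x) ^ (q ^ I) + \<alpha> * (l * y) ^ (q ^ J)"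
    and e2: "l * (x ^ (q ^ J) + \<beta> * z ^ (q ^ I)) = (l * x) ^ (q ^ J) + \<beta> * (l * z) ^ (q ^ I)"
    and e3: "l * (y ^ (q ^ I) + \<gamma> * z ^ (q ^ J)) = (l * y) ^ (q ^ I) + \<gamma> * (l * z) ^ (q ^ J)"
  shows "l ^ q = l"
proof -
  define A B where "A = l ^ (q ^ I) - l" and "B = l ^ (q ^ J) - l"
  have abc: "\<alpha> \<noteq> 0" "\<beta> \<noteq> 0" "\<gamma> \<noteq> 0"
    using adm by (auto simp: admissible_def)
  have 1: "A * x ^ (q ^ I) + \<alpha> * B * y ^ (q ^ J) = 0"
    using e1 by (simp add: A_def B_def power_mult_distrib algebra_simps)
  have 2: "B * x ^ (q ^ J) + \<beta> * A * z ^ (q ^ I) = 0"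
    using e2 by (simp add: A_def B_def power_mult_distrib algebra_simps)
  have 3: "A * y ^ (q ^ I) + \<gamma> * B * z ^ (q ^ J) = 0"
    using e3 by (simp add: A_def B_def power_mult_distrib algebra_simps)
  \<comment> \<open>If exactly one of \<open>A\<close>, \<open>B\<close> vanished, the three
    equations would force x, y and z all to be zero.\<close>
  have "A = 0 \<longleftrightarrow> B = 0"
    using 1 2 3 abc nz by auto
  moreover have "A = 0"
  proof (rule ccontr)
    assume "A \<noteq> 0"
    then have "B \<noteq> 0"
      using \<open>A = 0 \<longleftrightarrow> B = 0\<close> by simp
    \<comment> \<open>For nonzero \<open>A\<close> and \<open>B\<close> each equation makes two of
      the unknowns vanish together, so one nonzero unknown makes all three nonzero.\<close>
    have "x \<noteq> 0" "y \<noteq> 0" "z \<noteq> 0"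
      using 1 2 3 abc nz \<open>A \<noteq> 0\<close> \<open>B \<noteq> 0\<close> by (auto simp: power_0_left split: if_splits)
    moreover have "- B / A \<noteq> 0"
      using \<open>A \<noteq> 0\<close> \<open>B \<noteq> 0\<close> by simp
    moreover have "x ^ (q ^ I) = \<alpha> * (- B / A) * y ^ (q ^ J)"
      using 1 \<open>A \<noteq> 0\<close> by (simp add: field_simps eq_neg_iff_add_eq_0)
    moreover have "\<beta> * z ^ (q ^ I) = (- B / A) * x ^ (q ^ J)"
      using 2 \<open>A \<noteq> 0\<close> by (simp add: field_simps eq_neg_iff_add_eq_0)
    moreover have "y ^ (q ^ I) = \<gamma> * (- B / A) * z ^ (q ^ J)"
      using 3 \<open>A \<noteq> 0\<close> by (simp add: field_simps eq_neg_iff_add_eq_0)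
    moreover have "J = I + (J - I)"
      using IJ by simp
    ultimately show False
      using not_admissible_of_cycle abc(2) adm by blast
  qed
  ultimately show ?thesis
    using frob_fixed_imp_fixed[OF gcd] by (simp add: A_def B_def)
qed

text \<open>A scalar \<open>l\<close> relating two vectors of the set on one line is fixed by the
  q-th power map, hence lies in the image of \<open>emb\<close>; so each such intersection is
  spanned by one vector.\<close>

lemma U_set_scattered:
  fixes emb :: "'k::{finite,field} \<Rightarrow> 'a"
  assumes emb: "field_hom emb" "CARD('k) = q"
    and IJ: "I < J" and gcd: "gcd I (gcd J n) = 1"
    and adm: "admissible q (J - I) \<alpha> \<beta> \<gamma>"
  shows "scattered emb (U_set q I J \<alpha> \<beta> \<gamma>)"
proof -
  interpret V: vector_space "sub_scale emb :: 'k \<Rightarrow> 'a ^ 6 \<Rightarrow> 'a ^ 6"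
    by (rule vector_space_sub_scale[OF emb(1)])
  let ?U = "U_set q I J \<alpha> \<beta> \<gamma>"
  have "emb c ^ q = emb c" for c
    using field_hom_power[OF emb(1), of c q] power_card[of c] emb(2) by simp
  then have fixed: "emb c ^ (q ^ k) = emb c" for c k
    by (induction k) (simp_all add: power_mult)
  have "V.subspace ?U"
    by (rule V.subspaceI)
      (auto simp: U_set_iff sub_scale_def frob_add power_mult_distrib fixed power_0_left algebra_simps)
  moreover have "V.dim (?U \<inter> L) \<le> 1" if L: "vec.subspace L" "vec.dim L = 1" for L
  proof (cases "?U \<inter> L \<subseteq> {0}")
    case True
    then have "?U \<inter> L \<subseteq> V.span {}"
      by simp
    then show ?thesis
      using V.dim_le_card[of "?U \<inter> L" "{}"] by simp
  next
    case False
    then obtain u where u: "u \<in> ?U" "u \<in> L" "u \<noteq> 0"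
      by blast
    have "L \<subseteq> vec.span {u}"
      using vec.card_ge_dim_independent[of "{u}" L] u L by (simp add: vec.dependent_single)
    have "?U \<inter> L \<subseteq> V.span {u}"
    proof
      fix v
      assume v: "v \<in> ?U \<inter> L"
      then obtain l where l: "v = l *s u"
        using \<open>L \<subseteq> vec.span {u}\<close> by (auto simp: vec.span_singleton)
      \<comment> \<open>The last three coordinates are determined by the first three and vanish with
        them.\<close>
      have "u $ 1 \<noteq> 0 \<or> u $ 2 \<noteq> 0 \<or> u $ 3 \<noteq> 0"
        using u(1,3) by (auto simp: U_set_iff vec_eq_iff forall_6 power_0_left)
      then have "l ^ q = l"
        using eigenvalue_fixed[OF IJ gcd adm, of "u $ 1" "u $ 2" "u $ 3" l] u(1) v
        by (auto simp: U_set_iff l)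
      then obtain c where "l = emb c"
        using fixed_field_eq_range[OF emb(1)] emb(2) by auto
      then show "v \<in> V.span {u}"
        by (auto simp: l V.span_singleton sub_scale_def)
    qed
    then show ?thesis
      using V.dim_le_card[of "?U \<inter> L" "{u}"] by simp
  qed
  ultimately show ?thesis
    by (simp add: scattered_def)
qed

section \<open>Comparing coefficients for a linear map between two of the sets\<close>

text \<open>All exponents are below \<open>n\<close>, and \<open>2 * J\<close> exceeds the others,
  which isolates \<open>c5\<close>. But \<open>2 * I\<close> may equal \<open>J\<close>, so
  \<open>c2\<close> is isolated only once \<open>c3 = 0\<close>.\<close>

lemma linearised_six_terms:
  assumes IJ: "0 < I" "I < J" "2 * J < n"
    and zero: "\<And>t::'a. c0 * t + c1 * t ^ (q ^ I) + c2 * t ^ (q ^ J) + c3 * t ^ (q ^ (2 * I))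
      + c4 * t ^ (q ^ (I + J)) + c5 * t ^ (q ^ (2 * J)) = 0"
  shows "c5 = 0" "c3 = 0 \<Longrightarrow> c1 = 0 \<and> c2 = 0"
proof -
  \<comment> \<open>A sum of conditionals adds up the coefficients where exponents coincide.\<close>
  define f where "f k = (if k = 0 then c0 else 0) + (if k = I then c1 else 0)
    + (if k = J then c2 else 0) + (if k = 2 * I then c3 else 0)
    + (if k = I + J then c4 else 0) + (if k = 2 * J then c5 else 0)" for k
  have if_mult: "(if P then a else 0) * b = (if P then a * b else 0)" for P and a b :: 'a
    by simp
  have "(\<Sum>k<n. f k * t ^ (q ^ k)) = 0" for t
    using IJ zero[of t] by (simp add: f_def distrib_right sum.distrib if_mult sum.delta)
  then have f: "f k = 0" if "k < n" for k
    using linearised_coeffs_eq_0[OF q_gt_1 card_F] that by blast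
  show "c5 = 0"
    using f[of "2 * J"] IJ by (simp add: f_def)
  show "c1 = 0 \<and> c2 = 0" if "c3 = 0"
    using f[of I] f[of J] IJ that by (simp add: f_def split: if_splits)
qed

lemma frob_linear_combination:
  "(a * t + b * t ^ (q ^ i) + c * t ^ (q ^ j) :: 'a) ^ (q ^ k) =
     a ^ (q ^ k) * t ^ (q ^ k) + b ^ (q ^ k) * t ^ (q ^ (i + k)) + c ^ (q ^ k) * t ^ (q ^ (j + k))"
  by (simp add: frob_add power_mult_distrib power_add power_mult)

text \<open>Describes one defining equation of the target along a coordinate curve. The coefficient
  at \<open>2 * J\<close> is \<open>e * c2 ^ (q ^ J)\<close>, and \<open>b1 = 0\<close> removes the
  one at \<open>2 * I\<close>, after which those at \<open>I\<close> and \<open>J\<close> can be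
  compared.\<close>

lemma linearised_intertwiner:
  assumes IJ: "0 < I" "I < J" "2 * J < n" and "e \<noteq> 0"
    and eq: "\<And>t::'a. a4 * t + b4 * t ^ (q ^ I) + c4 * t ^ (q ^ J) =
      d * (a1 * t + b1 * t ^ (q ^ I) + c1 * t ^ (q ^ J)) ^ (q ^ I)
      + e * (a2 * t + b2 * t ^ (q ^ I) + c2 * t ^ (q ^ J)) ^ (q ^ J)"
  shows "c2 = 0" "b1 = 0 \<Longrightarrow> b4 = d * a1 ^ (q ^ I) \<and> c4 = e * a2 ^ (q ^ J)"
proof -
  have "- a4 * t + (d * a1 ^ (q ^ I) - b4) * t ^ (q ^ I) + (e * a2 ^ (q ^ J) - c4) * t ^ (q ^ J)
      + d * b1 ^ (q ^ I) * t ^ (q ^ (2 * I))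
      + (d * c1 ^ (q ^ I) + e * b2 ^ (q ^ J)) * t ^ (q ^ (I + J))
      + e * c2 ^ (q ^ J) * t ^ (q ^ (2 * J)) = 0" for t
    using eq[of t] unfolding frob_linear_combination mult_2 add.commute[of J I]
    by (simp add: algebra_simps)
  note * = linearised_six_terms[OF IJ this]
  show "c2 = 0"
    using *(1) \<open>e \<noteq> 0\<close> by simp
  show "b4 = d * a1 ^ (q ^ I) \<and> c4 = e * a2 ^ (q ^ J)" if "b1 = 0"
    using *(2) that by simp
qed

text \<open>Three coordinate curves and three defining equations of the target give nine identities
  between linearised polynomials, each treated by \<open>linearised_intertwiner\<close>.\<close>

lemma linear_equiv_params:
  fixes M :: "'a ^ 6 ^ 6"
  assumes IJ: "0 < I" "I < J" "2 * J < n"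
    and M: "invertible M" "\<And>u. u \<in> U_set q I J \<alpha> \<beta> \<gamma> \<Longrightarrow> M *v u \<in> U_set q I J \<alpha>' \<beta>' \<gamma>'"
    and nz: "\<alpha> \<noteq> 0" "\<beta> \<noteq> 0" "\<gamma> \<noteq> 0" "\<alpha>' \<noteq> 0" "\<beta>' \<noteq> 0" "\<gamma>' \<noteq> 0"
  shows "(\<alpha>', \<beta>', \<gamma>') \<in> torus_orbit (q ^ I) (q ^ J) (\<alpha>, \<beta>, \<gamma>)
    \<union> torus_orbit (q ^ I) (q ^ J) (\<gamma>, 1 / \<alpha>, 1 / \<beta>)
    \<union> torus_orbit (q ^ I) (q ^ J) (1 / \<beta>, 1 / \<gamma>, \<alpha>)"
proof -
  let ?m = "\<lambda>i j. M $ i $ j"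
  define v where "v x y z = (vector [x, y, z, x ^ (q ^ I) + \<alpha> * y ^ (q ^ J),
    x ^ (q ^ J) + \<beta> * z ^ (q ^ I), y ^ (q ^ I) + \<gamma> * z ^ (q ^ J)] :: 'a ^ 6)" for x y z :: 'a
  have v_nth: "(M *v v x y z) $ i = ?m i 1 * x + ?m i 2 * y + ?m i 3 * z
      + ?m i 4 * (x ^ (q ^ I) + \<alpha> * y ^ (q ^ J)) + ?m i 5 * (x ^ (q ^ J) + \<beta> * z ^ (q ^ I))
      + ?m i 6 * (y ^ (q ^ I) + \<gamma> * z ^ (q ^ J))" for x y z i
    by (simp add: matrix_vector_mult_def sum_6 v_def)
  have "v x y z \<in> U_set q I J \<alpha> \<beta> \<gamma>" for x y z
    by (simp add: U_set_iff v_def)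
  then have closed: "M *v v x y z \<in> U_set q I J \<alpha>' \<beta>' \<gamma>'" for x y z
    by (rule M(2))
  have X: "(M *v v t 0 0) $ i = ?m i 1 * t + ?m i 4 * t ^ (q ^ I) + ?m i 5 * t ^ (q ^ J)" for t i
    by (simp add: v_nth power_0_left)
  have Y: "(M *v v 0 t 0) $ i = ?m i 2 * t + ?m i 6 * t ^ (q ^ I) + (?m i 4 * \<alpha>) * t ^ (q ^ J)" for t i
    by (simp add: v_nth power_0_left algebra_simps)
  have Z: "(M *v v 0 0 t) $ i
      = ?m i 3 * t + (?m i 5 * \<beta>) * t ^ (q ^ I) + (?m i 6 * \<gamma>) * t ^ (q ^ J)" for t i
    by (simp add: v_nth power_0_left algebra_simps)
  have row4: "(M *v v x y z) $ 4
      = 1 * ((M *v v x y z) $ 1) ^ (q ^ I) + \<alpha>' * ((M *v v x y z) $ 2) ^ (q ^ J)"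
    and row5: "(M *v v x y z) $ 5
      = \<beta>' * ((M *v v x y z) $ 3) ^ (q ^ I) + 1 * ((M *v v x y z) $ 1) ^ (q ^ J)"
    and row6: "(M *v v x y z) $ 6
      = 1 * ((M *v v x y z) $ 2) ^ (q ^ I) + \<gamma>' * ((M *v v x y z) $ 3) ^ (q ^ J)" for x y z
    using closed[of x y z] by (simp_all add: U_set_iff)
  note intertwiner = linearised_intertwiner[OF IJ]
  note x4 = intertwiner[OF nz(4) row4[of _ 0 0, unfolded X]]
  note y4 = intertwiner[OF nz(4) row4[of 0 _ 0, unfolded Y]]
  note z4 = intertwiner[OF nz(4) row4[of 0 0, unfolded Z]]
  note x5 = intertwiner[OF one_neq_zero row5[of _ 0 0, unfolded X]]
  note y5 = intertwiner[OF one_neq_zero row5[of 0 _ 0, unfolded Y]]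
  note z5 = intertwiner[OF one_neq_zero row5[of 0 0, unfolded Z]]
  note x6 = intertwiner[OF nz(6) row6[of _ 0 0, unfolded X]]
  note y6 = intertwiner[OF nz(6) row6[of 0 _ 0, unfolded Y]]
  note z6 = intertwiner[OF nz(6) row6[of 0 0, unfolded Z]]
  \<comment> \<open>Each of the nine identities kills one entry of the upper right block.\<close>
  have zero: "?m 1 4 = 0" "?m 1 5 = 0" "?m 1 6 = 0" "?m 2 4 = 0" "?m 2 5 = 0" "?m 2 6 = 0"
      "?m 3 4 = 0" "?m 3 5 = 0" "?m 3 6 = 0"
    using x4(1) y4(1) z4(1) x5(1) y5(1) z5(1) x6(1) y6(1) z6(1) nz by simp_all
  \<comment> \<open>The identities express each entry of the lower right block twice. Equating the
    two expressions gives nine relations, in three groups that involve separate entries of the upper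
    left block: the diagonal and its two cyclic shifts.\<close>
  have diag: "\<alpha> * ?m 1 1 ^ (q ^ I) = \<alpha>' * ?m 2 2 ^ (q ^ J)"
      "\<beta> * ?m 1 1 ^ (q ^ J) = \<beta>' * ?m 3 3 ^ (q ^ I)"
      "\<gamma> * ?m 2 2 ^ (q ^ I) = \<gamma>' * ?m 3 3 ^ (q ^ J)"
    using x4(2) y4(2) x5(2) z5(2) y6(2) z6(2) zero by (simp_all add: mult.commute)
  have cyc: "\<gamma> * ?m 1 2 ^ (q ^ I) = \<alpha>' * ?m 2 3 ^ (q ^ J)"
      "?m 1 2 ^ (q ^ J) = \<beta>' * ?m 3 1 ^ (q ^ I) * \<alpha>"
      "?m 2 3 ^ (q ^ I) = \<gamma>' * ?m 3 1 ^ (q ^ J) * \<beta>"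
    using y4(2) z4(2) x5(2) y5(2) x6(2) z6(2) zero by (simp_all add: mult.commute)
  have cyc': "?m 1 3 ^ (q ^ I) = \<alpha>' * ?m 2 1 ^ (q ^ J) * \<beta>"
      "?m 1 3 ^ (q ^ J) = \<beta>' * ?m 3 2 ^ (q ^ I) * \<gamma>"
      "\<alpha> * ?m 2 1 ^ (q ^ I) = \<gamma>' * ?m 3 2 ^ (q ^ J)"
    using z4(2) x4(2) y5(2) z5(2) x6(2) y6(2) zero by (simp_all add: mult.commute)
  obtain M' where M': "M ** M' = mat 1"
    using M(1) by (auto simp: invertible_def)
  \<comment> \<open>The right half of the first row is zero, so invertibility needs a nonzero entry
    in the left half; the relations carry it to the rest of its group.\<close>
  have "?m 1 1 \<noteq> 0 \<or> ?m 1 2 \<noteq> 0 \<or> ?m 1 3 \<noteq> 0"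
  proof (rule ccontr)
    assume "\<not> (?m 1 1 \<noteq> 0 \<or> ?m 1 2 \<noteq> 0 \<or> ?m 1 3 \<noteq> 0)"
    then have "(M ** M') $ 1 $ 1 = 0"
      using zero by (simp add: matrix_matrix_mult_def sum_6)
    then show False
      by (simp add: M' mat_def)
  qed
  then consider "?m 1 1 \<noteq> 0" | "?m 1 2 \<noteq> 0" | "?m 1 3 \<noteq> 0"
    by blast
  then show ?thesis
  proof cases
    case 1
    moreover from this have "?m 2 2 \<noteq> 0" "?m 3 3 \<noteq> 0"
      using diag(1,2) nz by (auto simp: power_0_left)
    ultimately have "(\<alpha>', \<beta>', \<gamma>') \<in> torus_orbit (q ^ I) (q ^ J) (\<alpha>, \<beta>, \<gamma>)"
      using diag by (intro torus_orbitI[of "?m 1 1" "?m 2 2" "?m 3 3"]) (simp_all add: field_simps)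
    then show ?thesis
      by blast
  next
    case 2
    moreover from this have "?m 2 3 \<noteq> 0" "?m 3 1 \<noteq> 0"
      using cyc(1,2) nz by (auto simp: power_0_left)
    ultimately have "(\<alpha>', \<beta>', \<gamma>') \<in> torus_orbit (q ^ I) (q ^ J) (\<gamma>, 1 / \<alpha>, 1 / \<beta>)"
      using cyc nz by (intro torus_orbitI[of "?m 1 2" "?m 2 3" "?m 3 1"]) (simp_all add: field_simps)
    then show ?thesis
      by blast
  next
    case 3
    moreover from this have "?m 2 1 \<noteq> 0" "?m 3 2 \<noteq> 0"
      using cyc'(1,2) nz by (auto simp: power_0_left)
    ultimately have "(\<alpha>', \<beta>', \<gamma>') \<in> torus_orbit (q ^ I) (q ^ J) (1 / \<beta>, 1 / \<gamma>, \<alpha>)"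
      using cyc' nz by (intro torus_orbitI[of "?m 1 3" "?m 2 1" "?m 3 2"]) (simp_all add: field_simps)
    then show ?thesis
      by blast
  qed
qed

section \<open>Parameters of semilinearly equivalent sets\<close>

text \<open>The three orbits of \<open>linear_equiv_params\<close>, collected over all conjugates of
  the parameters under field automorphisms.\<close>

definition equiv_params :: "nat \<Rightarrow> nat \<Rightarrow> 'a \<times> 'a \<times> 'a \<Rightarrow> ('a \<times> 'a \<times> 'a) set" where
  "equiv_params I J = (\<lambda>(\<alpha>, \<beta>, \<gamma>). \<Union>s\<in>{s. field_aut s}.
     torus_orbit (q ^ I) (q ^ J) (s \<alpha>, s \<beta>, s \<gamma>)
     \<union> torus_orbit (q ^ I) (q ^ J) (s \<gamma>, 1 / s \<alpha>, 1 / s \<beta>)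
     \<union> torus_orbit (q ^ I) (q ^ J) (1 / s \<beta>, 1 / s \<gamma>, s \<alpha>))"

text \<open>Automorphisms commute with powers, so \<open>s\<close> carries the first set onto the
  one with parameters \<open>s \<alpha>\<close>, \<open>s \<beta>\<close>,
  \<open>s \<gamma>\<close>, and the remaining map is linear.\<close>

lemma GammaL_equiv_imp_equiv_params:
  assumes IJ: "0 < I" "I < J" "2 * J < n"
    and equiv: "GammaL_equiv (U_set q I J \<alpha> \<beta> \<gamma>) (U_set q I J \<alpha>' \<beta>' (\<gamma>' :: 'a))"
    and nz: "\<alpha> \<noteq> 0" "\<beta> \<noteq> 0" "\<gamma> \<noteq> 0" "\<alpha>' \<noteq> 0" "\<beta>' \<noteq> 0" "\<gamma>' \<noteq> 0"
  shows "(\<alpha>', \<beta>', \<gamma>') \<in> equiv_params I J (\<alpha>, \<beta>, \<gamma>)"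
proof -
  obtain M :: "'a ^ 6 ^ 6" and s where M: "invertible M" and s: "field_aut s"
    and U': "U_set q I J \<alpha>' \<beta>' \<gamma>' = (\<lambda>u. M *v (\<chi> i. s (u $ i))) ` U_set q I J \<alpha> \<beta> \<gamma>"
    using equiv by (auto simp: GammaL_equiv_def)
  have hom: "field_hom s" and "surj s"
    using s by (auto simp: field_aut_def bij_def)
  have s_simps: "s (x + y) = s x + s y" "s (x * y) = s x * s y" for x y
    using hom by (auto simp: field_hom_def)
  have "M *v u \<in> U_set q I J \<alpha>' \<beta>' \<gamma>'" if u: "u \<in> U_set q I J (s \<alpha>) (s \<beta>) (s \<gamma>)" for u
  proof -
    define w where "w = (\<chi> i. inv_into UNIV s (u $ i))"
    have sw: "(\<chi> i. s (w $ i)) = u"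
      using \<open>surj s\<close> by (simp add: w_def surj_f_inv_f vec_eq_iff)
    have "w \<in> U_set q I J \<alpha> \<beta> \<gamma>"
    proof -
      have "s (w $ i) = u $ i" for i
        using sw by (auto simp: vec_eq_iff)
      then have "s (w $ 4) = s ((w $ 1) ^ (q ^ I) + \<alpha> * (w $ 2) ^ (q ^ J))"
        "s (w $ 5) = s ((w $ 1) ^ (q ^ J) + \<beta> * (w $ 3) ^ (q ^ I))"
        "s (w $ 6) = s ((w $ 2) ^ (q ^ I) + \<gamma> * (w $ 3) ^ (q ^ J))"
        using u by (simp_all add: U_set_iff s_simps field_hom_power[OF hom])
      then show ?thesis
        using field_hom_inj[OF hom] by (simp add: U_set_iff inj_eq)
    qed
    then have "M *v (\<chi> i. s (w $ i)) \<in> U_set q I J \<alpha>' \<beta>' \<gamma>'"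
      unfolding U' by blast
    then show ?thesis
      by (simp add: sw)
  qed
  then have "(\<alpha>', \<beta>', \<gamma>') \<in> torus_orbit (q ^ I) (q ^ J) (s \<alpha>, s \<beta>, s \<gamma>)
    \<union> torus_orbit (q ^ I) (q ^ J) (s \<gamma>, 1 / s \<alpha>, 1 / s \<beta>)
    \<union> torus_orbit (q ^ I) (q ^ J) (1 / s \<beta>, 1 / s \<gamma>, s \<alpha>)"
    by (rule linear_equiv_params[OF IJ M]) (use nz field_hom_nonzero[OF hom] in auto)
  then show ?thesis
    using s by (auto simp: equiv_params_def)
qed

section \<open>Counting orbits, admissible parameters and classes\<close>

lemma card_nonzero: "card (- {0 :: 'a}) = q ^ n - 1"
  by (simp add: Compl_eq_Diff_UNIV card_Diff_singleton card_F)

lemma units_pos: "q ^ n - 1 > 0"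
  using one_less_power[OF q_gt_1, of n] n_pos by simp

text \<open>The orbit is the image of a map on the torus whose fibres have at least
  \<open>gcd (q ^ (3 * K) - 1) (q ^ n - 1)\<close> elements, by the action of a stabiliser.\<close>

lemma card_torus_orbit:
  fixes t :: "'a \<times> 'a \<times> 'a"
  assumes J: "J = I + K"
  shows "card (torus_orbit (q ^ I) (q ^ J) t) * gcd (q ^ (3 * K) - 1) (q ^ n - 1) \<le> (q ^ n - 1) ^ 3"
proof -
  obtain \<alpha> \<beta> \<gamma> where t: "t = (\<alpha>, \<beta>, \<gamma>)"
    using prod_cases3 by blast
  define A where "A = (- {0 :: 'a}) \<times> (- {0 :: 'a}) \<times> (- {0 :: 'a})"
  define f where "f = (\<lambda>(a, b, c). (\<alpha> * a ^ (q ^ I) / b ^ (q ^ J), \<beta> * a ^ (q ^ J) / c ^ (q ^ I),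
    \<gamma> * b ^ (q ^ I) / c ^ (q ^ J)))"
  define Q where "Q = q ^ K"
  define G where "G = gcd (q ^ (3 * K) - 1) (q ^ n - 1)"
  have exps: "q ^ J = q ^ I * Q" and Q3: "q ^ (3 * K) = Q ^ 3"
    by (simp_all add: J Q_def power_add mult.commute flip: power_mult)
  have "G \<le> card {y \<in> A. f y = f x}" if "x \<in> A" for x
  proof -
    obtain a b c where x: "x = (a, b, c)" and nz: "a \<noteq> 0" "b \<noteq> 0" "c \<noteq> 0"
      using \<open>x \<in> A\<close> by (auto simp: A_def)
    \<comment> \<open>The triple \<open>(s ^ (Q ^ 2), s ^ Q, s)\<close> acts trivially when
      \<open>s ^ (Q ^ 3) = s\<close>; its last entry makes \<open>g\<close> injective.\<close>
    define g where "g s = (a * s ^ (Q ^ 2), b * s ^ Q, c * s)" for s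
    have "g s \<in> {y \<in> A. f y = f x}" if "s ^ G = 1" for s :: 'a
    proof -
      have "s ^ (q ^ (3 * K) - 1) = 1"
        using \<open>s ^ G = 1\<close> by (metis G_def dvdE gcd_dvd1 power_mult power_one)
      moreover have "q ^ (3 * K) = Suc (q ^ (3 * K) - 1)"
        by simp
      ultimately have fixed: "s ^ (Q ^ 3) = s"
        by (metis Q3 mult.right_neutral power_Suc)
      have "s \<noteq> 0"
        using fixed \<open>s ^ G = 1\<close> units_pos by (auto simp: G_def power_0_left)
      have "(s ^ (Q ^ 2)) ^ (q ^ J) = s ^ (q ^ I)"
      proof -
        have "(s ^ (Q ^ 2)) ^ (q ^ J) = (s ^ (Q ^ 3)) ^ (q ^ I)"
          unfolding exps power_mult[symmetric] by (simp add: power2_eq_square power3_eq_cube mult_ac)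
        then show ?thesis
          by (simp add: fixed)
      qed
      moreover have "(s ^ (Q ^ 2)) ^ (q ^ I) = (s ^ Q) ^ (q ^ J)" "(s ^ Q) ^ (q ^ I) = s ^ (q ^ J)"
        unfolding exps power_mult[symmetric] by (simp_all add: power2_eq_square mult_ac)
      ultimately show ?thesis
        using nz \<open>s \<noteq> 0\<close> by (simp add: g_def x A_def f_def power_mult_distrib)
    qed
    then have "card (g ` {s. s ^ G = 1}) \<le> card {y \<in> A. f y = f x}"
      by (intro card_mono) auto
    moreover have "inj_on g {s. s ^ G = 1}"
      using nz by (auto simp: inj_on_def g_def)
    moreover have "G \<le> card {s::'a. s ^ G = 1}"
      by (rule card_roots_of_unity_ge) (simp add: G_def card_F)
    ultimately show ?thesis
      by (simp add: card_image)
  qed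
  then have "card (f ` A) * G \<le> card A"
    by (intro card_image_mult_le) auto
  moreover have "torus_orbit (q ^ I) (q ^ J) t = f ` A"
    by (simp add: torus_orbit_def t f_def A_def)
  moreover have "card A = (q ^ n - 1) ^ 3"
    by (simp add: A_def card_cartesian_product card_nonzero power3_eq_cube)
  ultimately show ?thesis
    by (simp add: G_def)
qed

text \<open>There are at most \<open>h * n\<close> automorphisms, with three orbits for
  each.\<close>

lemma card_equiv_params:
  assumes "J = I + K"
  shows "card (equiv_params I J t) * gcd (q ^ (3 * K) - 1) (q ^ n - 1)
    \<le> 3 * n * h * (q ^ n - 1) ^ 3"
proof -
  define G where "G = gcd (q ^ (3 * K) - 1) (q ^ n - 1)"
  obtain \<alpha> \<beta> \<gamma> where t: "t = (\<alpha>, \<beta>, \<gamma>)"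
    using prod_cases3 by blast
  define S where "S = {s :: 'a \<Rightarrow> 'a. field_aut s}"
  let ?T = "\<lambda>t. torus_orbit (q ^ I) (q ^ J) t"
  let ?B = "\<lambda>s. ?T (s \<alpha>, s \<beta>, s \<gamma>) \<union> ?T (s \<gamma>, 1 / s \<alpha>, 1 / s \<beta>) \<union> ?T (1 / s \<beta>, 1 / s \<gamma>, s \<alpha>)"
  have B: "card (?B s) * G \<le> 3 * (q ^ n - 1) ^ 3" for s :: "'a \<Rightarrow> 'a"
  proof -
    have "card (?B s) \<le> card (?T (s \<alpha>, s \<beta>, s \<gamma>)) + card (?T (s \<gamma>, 1 / s \<alpha>, 1 / s \<beta>))
        + card (?T (1 / s \<beta>, 1 / s \<gamma>, s \<alpha>))"
      by (intro order.trans[OF card_Un_le] add_mono order_refl card_Un_le)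
    then have "card (?B s) * G \<le> card (?T (s \<alpha>, s \<beta>, s \<gamma>)) * G
        + card (?T (s \<gamma>, 1 / s \<alpha>, 1 / s \<beta>)) * G + card (?T (1 / s \<beta>, 1 / s \<gamma>, s \<alpha>)) * G"
      unfolding distrib_right[symmetric] by (rule mult_le_mono1)
    also have "\<dots> \<le> (q ^ n - 1) ^ 3 + (q ^ n - 1) ^ 3 + (q ^ n - 1) ^ 3"
      unfolding G_def by (intro add_mono card_torus_orbit assms)
    finally show ?thesis
      by simp
  qed
  have "card (equiv_params I J t) * G \<le> (\<Sum>s\<in>S. card (?B s)) * G"
    unfolding equiv_params_def t S_def prod.case by (intro mult_le_mono1 card_UN_le) simp
  also have "\<dots> = (\<Sum>s\<in>S. card (?B s) * G)"
    by (rule sum_distrib_right)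
  also have "\<dots> \<le> (\<Sum>s\<in>S. 3 * (q ^ n - 1) ^ 3)"
    by (intro sum_mono B)
  also have "\<dots> = card S * (3 * (q ^ n - 1) ^ 3)"
    by simp
  also have "\<dots> \<le> (h * n) * (3 * (q ^ n - 1) ^ 3)"
    unfolding S_def by (intro mult_le_mono1 card_field_aut_le[OF prime_p card_F'])
  finally show ?thesis
    by (simp add: G_def mult_ac)
qed

text \<open>Nonzero powers of the forbidden exponent are roots of unity of order dividing
  \<open>(q ^ n - 1) div g\<close>, which bounds their number.\<close>

lemma card_admissible:
  fixes K :: nat
  defines "g \<equiv> gcd (q ^ (2 * K) + q ^ K + 1) (q ^ n - 1)"
  shows "(q ^ n - 1) ^ 2 * (q ^ n - 1 - (q ^ n - 1) div g)
    \<le> card {(\<alpha>, \<beta>, \<gamma>). admissible q K \<alpha> \<beta> (\<gamma> :: 'a)}"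
proof -
  let ?d = "q ^ (2 * K) + q ^ K + 1" and ?N = "q ^ n - 1" and ?Q = "q ^ K"
  define P where "P = {x :: 'a. x \<noteq> 0 \<and> is_nth_power ?d x}"
  have "g dvd ?N" "g dvd ?d"
    unfolding g_def by (rule gcd_dvd2, rule gcd_dvd1)
  then have N: "?N = g * (?N div g)" and d: "?d = g * (?d div g)"
    by simp_all
  have "?N div g > 0"
    using N units_pos by (metis gr0I mult_0_right)
  have "P \<subseteq> {x. x ^ (?N div g) = 1}"
  proof
    fix x
    assume "x \<in> P"
    then obtain y where y: "x = y ^ ?d" "y \<noteq> 0"
      by (auto simp: P_def is_nth_power_def power_0_left split: if_splits)
    have "?d * (?N div g) = ?N * (?d div g)"
      unfolding div_mult_swap[OF \<open>g dvd ?N\<close>] div_mult_swap[OF \<open>g dvd ?d\<close>]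
      by (simp only: mult.commute)
    then have "x ^ (?N div g) = (y ^ ?N) ^ (?d div g)"
      unfolding y(1) power_mult[symmetric] by (simp only:)
    also have "\<dots> = 1"
      using power_card_minus_1[OF y(2)] by (simp add: card_F)
    finally show "x \<in> {x. x ^ (?N div g) = 1}"
      by simp
  qed
  then have "card P \<le> card {x :: 'a. x ^ (?N div g) = 1}"
    by (rule card_mono[rotated]) simp
  also have "\<dots> \<le> ?N div g"
    by (rule card_roots_of_unity_le) fact
  finally have "?N - ?N div g \<le> card (- {0} - P)"
    by (subst card_Diff_subset) (auto simp: card_nonzero P_def)
  then have "?N ^ 2 * (?N - ?N div g) \<le> card ((- {0} - P) \<times> (- {0 :: 'a}) \<times> (- {0 :: 'a}))"
    by (simp add: card_cartesian_product card_nonzero power2_eq_square)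
  also have "\<dots> \<le> card {(\<alpha>, \<beta>, \<gamma>). admissible q K \<alpha> \<beta> (\<gamma> :: 'a)}"
  proof (rule card_inj_on_le)
    \<comment> \<open>For nonzero \<open>\<beta>\<close> and \<open>\<gamma>\<close>, the first
      parameter is recovered from the product \<open>w\<close> tested in \<open>admissible\<close>,
      so \<open>w\<close> can replace it in the count.\<close>
    let ?f = "\<lambda>(w, \<beta>, \<gamma>). (w / (\<gamma> ^ ?Q * \<beta> ^ (?Q + 1)), \<beta>, \<gamma> :: 'a)"
    show "inj_on ?f ((- {0} - P) \<times> (- {0}) \<times> (- {0}))"
      by (auto simp: inj_on_def)
    show "?f ` ((- {0} - P) \<times> (- {0}) \<times> (- {0})) \<subseteq> {(\<alpha>, \<beta>, \<gamma>). admissible q K \<alpha> \<beta> \<gamma>}"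
      by (auto simp: admissible_def P_def)
  qed simp
  finally show ?thesis .
qed

text \<open>Sending admissible triples to classes has fibres inside \<open>equiv_params\<close>, so
  the number of classes is at least the number of triples over the fibre bound.\<close>

lemma card_GammaL_classes:
  assumes IJ: "0 < I" "I < J" "2 * J < n" and J: "J = I + K"
  defines "G \<equiv> gcd (q ^ (3 * K) - 1) (q ^ n - 1)"
    and "g \<equiv> gcd (q ^ (2 * K) + q ^ K + 1) (q ^ n - 1)"
    and "C \<equiv> card ({U_set q I J \<alpha> \<beta> \<gamma> | (\<alpha>::'a) \<beta> \<gamma>. admissible q K \<alpha> \<beta> \<gamma>}
      // {(U :: ('a ^ 6) set, U'). GammaL_equiv U U'})"
  shows "1 / (3 * real n * real h) * (real G - real G / real g) \<le> real C"
proof -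
  define N where "N = q ^ n - 1"
  define A where "A = {(\<alpha>, \<beta>, \<gamma>). admissible q K \<alpha> \<beta> (\<gamma> :: 'a)}"
  define R where "R = {(U :: ('a ^ 6) set, U'). GammaL_equiv U U'}"
  define U where "U = (\<lambda>(\<alpha>, \<beta>, \<gamma> :: 'a). U_set q I J \<alpha> \<beta> \<gamma>)"
  define cls where "cls t = R `` {U t}" for t
  \<comment> \<open>Rounding down is harmless: the fibre size is an integer, and \<open>m\<close> is
    later multiplied by \<open>G\<close> again.\<close>
  define m where "m = 3 * n * h * N ^ 3 div G"
  have "N > 0" "G > 0"
    using units_pos by (simp_all add: N_def G_def)
  have fibre: "card {t' \<in> A. cls t' = cls t} \<le> m" if "t \<in> A" for t
  proof -
    have "{t' \<in> A. cls t' = cls t} \<subseteq> equiv_params I J t"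
    proof
      fix t'
      assume t': "t' \<in> {t' \<in> A. cls t' = cls t}"
      then have "U t' \<in> cls t"
        using GammaL_equiv_refl[of "U t'"] by (auto simp: cls_def R_def)
      then have "GammaL_equiv (U t) (U t')"
        by (simp add: cls_def R_def)
      then show "t' \<in> equiv_params I J t"
        using GammaL_equiv_imp_equiv_params[OF IJ] t' that
        by (auto simp: A_def U_def admissible_def)
    qed
    then have "card {t' \<in> A. cls t' = cls t} \<le> card (equiv_params I J t)"
      by (intro card_mono) simp_all
    also have "\<dots> \<le> m"
      using card_equiv_params[OF J, of t] \<open>G > 0\<close> by (simp add: m_def N_def G_def less_eq_div_iff_mult_less_eq)
    finally show ?thesis .
  qed
  have "{U_set q I J \<alpha> \<beta> \<gamma> | (\<alpha>::'a) \<beta> \<gamma>. admissible q K \<alpha> \<beta> \<gamma>} = U ` A"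
    by (auto simp: A_def U_def image_iff)
  moreover have "(U ` A) // R = cls ` A"
    by (auto simp: quotient_def cls_def)
  ultimately have C: "C = card (cls ` A)"
    by (simp add: C_def R_def)
  have "N ^ 2 * (N - N div g) \<le> card A"
    unfolding A_def N_def g_def by (rule card_admissible)
  also have "\<dots> \<le> C * m"
    unfolding C using fibre by (intro card_le_card_image_mult) simp_all
  finally have "G * (N ^ 2 * (N - N div g)) \<le> G * (C * m)"
    by (rule mult_le_mono2)
  also have "\<dots> \<le> C * (3 * n * h * N ^ 3)"
    by (simp add: m_def mult.left_commute[of G])
  finally have "N ^ 2 * (G * (N - N div g)) \<le> N ^ 2 * (C * (3 * n * h * N))"
    by (simp add: power2_eq_square power3_eq_cube mult_ac)
  then have "G * (N - N div g) \<le> C * (3 * n * h * N)"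
    using \<open>N > 0\<close> by simp
  then have "real (G * (N - N div g)) \<le> real (C * (3 * n * h * N))"
    by (simp only: of_nat_le_iff)
  then have "real G * (real N - real (N div g)) \<le> real C * (3 * real n * real h * real N)"
    by (simp only: of_nat_mult of_nat_diff[OF div_le_dividend] of_nat_numeral)
  \<comment> \<open>This division is exact because \<open>g\<close> divides
    \<open>N\<close>.\<close>
  moreover have "real (N div g) = real N / real g"
    by (rule real_of_nat_div) (simp add: g_def N_def)
  ultimately have "real N * (real G - real G / real g) \<le> real N * (real C * (3 * real n * real h))"
    by (simp add: algebra_simps)
  then have "real G - real G / real g \<le> real C * (3 * real n * real h)"
    using \<open>N > 0\<close> by (simp only: mult_le_cancel_left_pos of_nat_0_less_iff)
  then show ?thesis
    using n_pos h_pos by (simp add: field_simps)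
qed

end

theorem mainTheorem10:
  fixes p h q n I J K :: nat
    and emb :: "'k::{finite,field} \<Rightarrow> 'a::{finite,field}"
  assumes "prime p" and "h \<ge> 1" and "q = p ^ h" and "n \<ge> 1"
    and "CARD('k) = q" and "CARD('a) = q ^ n" and "field_hom emb"
    and "0 < I" and "I < J" and "real J < real n / 2"
    and "gcd I (gcd J n) = 1"
    and "K = J - I"
  shows "(\<forall>(\<alpha>::'a) \<beta> \<gamma>. admissible q K \<alpha> \<beta> \<gamma> \<longrightarrow> scattered emb (U_set q I J \<alpha> \<beta> \<gamma>)) \<and>
    real (card ({U_set q I J \<alpha> \<beta> \<gamma> | (\<alpha>::'a) \<beta> \<gamma>. admissible q K \<alpha> \<beta> \<gamma>}
                // {(U :: ('a ^ 6) set, U'). GammaL_equiv U U'}))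
      \<ge> 1 / (3 * real n * real h) *
          (real (gcd (q ^ (3 * K) - 1) (q ^ n - 1))
           - real (gcd (q ^ (3 * K) - 1) (q ^ n - 1))
             / real (gcd (q ^ (2 * K) + q ^ K + 1) (q ^ n - 1)))"
proof -
  interpret fq_extension p h q n "TYPE('a)"
    by unfold_locales fact+
  have "2 * J < n"
    using \<open>real J < real n / 2\<close> by linarith
  have "J = I + K"
    using \<open>I < J\<close> \<open>K = J - I\<close> by simp
  show ?thesis
  proof (intro conjI allI impI)
    show "scattered emb (U_set q I J \<alpha> \<beta> \<gamma>)" if "admissible q K \<alpha> \<beta> \<gamma>" for \<alpha> \<beta> \<gamma> :: 'a
      using U_set_scattered[OF \<open>field_hom emb\<close> \<open>CARD('k) = q\<close> \<open>I < J\<close> \<open>gcd I (gcd J n) = 1\<close>]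
        that \<open>K = J - I\<close> by simp
  qed (rule card_GammaL_classes[OF \<open>0 < I\<close> \<open>I < J\<close> \<open>2 * J < n\<close> \<open>J = I + K\<close>])
qed

end
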